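(* Let $X_0 = [\, h_I : I\in \mathcal{D}^n,\ n\in\mathbb{N}_0 \text{ even}\,]$ and $X_1 = [\, h_I : I\in \mathcal{D}^n,\ n\in\mathbb{N}_0 \text{ odd}\,]$ be the closed linear spans in $L^1 = L^1[0,1]$ of the even, respectively odd, levels of the Haar system. Then the Banach space $X_0$ is isomorphic to the Banach space $X_1$.
   Context: $\mathbb{N}_0 = \{0,1,2,\dots\}$. $L^1 = L^1[0,1]$ is the Banach space of (classes of) Lebesgue integrable scalar-valued functions on $[0,1]$ with the usual norm. For $n\in\mathbb{N}_0$, $\mathcal{D}^n = \{[\frac{i-1}{2^n},\frac{i}{2^n}) : 1\le i\le 2^n\}$ is the set of dyadic intervals of level $n$. For a dyadic interval $I$, $I^+$ denotes its left half and $I^-$ its right half, and the Haar function is $h_I = \chi_{I^+}-\chi_{I^-}$. The $n$-th level of the Haar system is $\{h_I : I\in\mathcal{D}^n\}$; the constant function $\chi_{[0,1)}$ is not included in any level. $[F]$ denotes the closed linear span of a subset $F$ of a Banach space. Two Banach spaces are isomorphic if there is a bounded linear bijection between them with bounded inverse. *)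

theory Defs
  imports "HOL-Analysis.Analysis"
begin

section \<open>The Banach space \<open>L\<^sup>1[0,1]\<close>\<close>

text \<open>
  Elements are almost-everywhere classes of Lebesgue integrable functions on \<open>[0,1]\<close>. The
  values are in a Banach space here; only the scalar fields \<open>real\<close> and \<open>complex\<close> are used
  in the end. Values of a representative outside \<open>[0,1]\<close> are irrelevant.
\<close>

quotient_type (overloaded) 'a L1 =
  "real \<Rightarrow> 'a::{banach, second_countable_topology}" / partial:
  "\<lambda>f g. integrable (lebesgue_on {0..1}) f \<and> integrable (lebesgue_on {0..1}) g \<and>
         (AE x in lebesgue_on {0..1}. f x = g x)"
  morphisms rep_L1 Abs_L1
proof (rule part_equivpI)
  show "\<exists>f. integrable (lebesgue_on {0..1}) f \<and> integrable (lebesgue_on {0..1}) f \<and>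
         (AE x in lebesgue_on {0..1}. f x = (f x :: 'a))"
    by (rule exI[of _ "\<lambda>_. 0"]) simp
qed (auto intro!: sympI transpI elim: eventually_mono eventually_elim2)

instantiation L1 :: ("{banach, second_countable_topology}") real_normed_vector
begin

lift_definition zero_L1 :: "'a L1" is "\<lambda>_. 0"
  by simp

lift_definition plus_L1 :: "'a L1 \<Rightarrow> 'a L1 \<Rightarrow> 'a L1" is "\<lambda>f g x. f x + g x"
  by (auto elim: eventually_elim2)

lift_definition minus_L1 :: "'a L1 \<Rightarrow> 'a L1 \<Rightarrow> 'a L1" is "\<lambda>f g x. f x - g x"
  by (auto elim: eventually_elim2)

lift_definition uminus_L1 :: "'a L1 \<Rightarrow> 'a L1" is "\<lambda>f x. - f x"
  by auto

lift_definition scaleR_L1 :: "real \<Rightarrow> 'a L1 \<Rightarrow> 'a L1" is "\<lambda>c f x. c *\<^sub>R f x"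
  by (auto elim: eventually_mono)

lift_definition norm_L1 :: "'a L1 \<Rightarrow> real"
  is "\<lambda>f. integral\<^sup>L (lebesgue_on {0..1}) (\<lambda>x. norm (f x))"
  by (rule integral_cong_AE) (auto elim: eventually_mono)

definition dist_L1 :: "'a L1 \<Rightarrow> 'a L1 \<Rightarrow> real"
  where "dist_L1 f g = norm (f - g)"

definition sgn_L1 :: "'a L1 \<Rightarrow> 'a L1"
  where "sgn_L1 f = inverse (norm f) *\<^sub>R f"

definition uniformity_L1 :: "('a L1 \<times> 'a L1) filter"
  where "uniformity_L1 = (INF e\<in>{0<..}. principal {(f, g). dist f g < e})"

definition open_L1 :: "'a L1 set \<Rightarrow> bool"
  where "open_L1 U \<longleftrightarrow> (\<forall>f\<in>U. \<forall>\<^sub>F (f', g) in uniformity. f' = f \<longrightarrow> g \<in> U)"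

instance
proof
  fix f g h :: "'a L1" and a b :: real
  show "f + g + h = f + (g + h)"
    by transfer (auto simp: add.assoc elim!: eventually_elim2)
  show "f + g = g + f"
    by transfer (auto simp: add.commute elim!: eventually_elim2)
  show "0 + f = f"
    by transfer auto
  show "- f + f = 0"
    by transfer auto
  show "f - g = f + - g"
    by transfer auto
  show "a *\<^sub>R (f + g) = a *\<^sub>R f + a *\<^sub>R g"
    by transfer (auto simp: scaleR_add_right)
  show "(a + b) *\<^sub>R f = a *\<^sub>R f + b *\<^sub>R f"
    by transfer (auto simp: scaleR_add_left)
  show "a *\<^sub>R b *\<^sub>R f = (a * b) *\<^sub>R f"
    by transfer auto
  show "1 *\<^sub>R f = f"
    by transfer auto
  show "dist f g = norm (f - g)"
    by (rule dist_L1_def)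
  show "sgn f = inverse (norm f) *\<^sub>R f"
    by (rule sgn_L1_def)
  show "uniformity = (INF e\<in>{0<..}. principal {(f :: 'a L1, g). dist f g < e})"
    by (rule uniformity_L1_def)
  show "open U \<longleftrightarrow> (\<forall>f\<in>U. \<forall>\<^sub>F (f', g) in uniformity. f' = f \<longrightarrow> g \<in> U)" for U :: "'a L1 set"
    by (rule open_L1_def)
  show "norm f = 0 \<longleftrightarrow> f = 0"
    by transfer (auto simp: integral_nonneg_eq_0_iff_AE)
  show "norm (f + g) \<le> norm f + norm g"
  proof transfer
    fix f g :: "real \<Rightarrow> 'a"
    let ?M = "lebesgue_on {0..1::real}"
    assume "integrable ?M f \<and> integrable ?M f \<and> (AE x in ?M. f x = f x)"
      and "integrable ?M g \<and> integrable ?M g \<and> (AE x in ?M. g x = g x)"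
    hence f: "integrable ?M f" and g: "integrable ?M g" by auto
    have "integral\<^sup>L ?M (\<lambda>x. norm (f x + g x)) \<le> integral\<^sup>L ?M (\<lambda>x. norm (f x) + norm (g x))"
      using f g by (intro integral_mono) (auto simp: norm_triangle_ineq)
    also have "\<dots> = integral\<^sup>L ?M (\<lambda>x. norm (f x)) + integral\<^sup>L ?M (\<lambda>x. norm (g x))"
      using f g by (intro Bochner_Integration.integral_add) auto
    finally show "integral\<^sup>L ?M (\<lambda>x. norm (f x + g x))
      \<le> integral\<^sup>L ?M (\<lambda>x. norm (f x)) + integral\<^sup>L ?M (\<lambda>x. norm (g x))" .
  qed
  show "norm (a *\<^sub>R f) = \<bar>a\<bar> * norm f"
    by transfer simp
qed

end

lift_definition scale_L1 ::
  "'k::{real_normed_field, banach, second_countable_topology} \<Rightarrow> 'k L1 \<Rightarrow> 'k L1"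
  is "\<lambda>c f x. c * f x"
  by (auto elim: eventually_mono)

global_interpretation L1: vector_space scale_L1
proof
  fix a b :: "'k::{real_normed_field, banach, second_countable_topology}" and f g :: "'k L1"
  show "scale_L1 a (f + g) = scale_L1 a f + scale_L1 a g"
    by transfer (auto simp: algebra_simps)
  show "scale_L1 (a + b) f = scale_L1 a f + scale_L1 b f"
    by transfer (auto simp: algebra_simps)
  show "scale_L1 a (scale_L1 b f) = scale_L1 (a * b) f"
    by transfer (auto simp: algebra_simps)
  show "scale_L1 1 f = f"
    by transfer auto
qed

lemma scale_L1_of_real: "scale_L1 (of_real r) f = r *\<^sub>R f"
  by transfer (auto simp: scaleR_conv_of_real)

lemma norm_scale_L1: "norm (scale_L1 c f) = norm c * norm f"
  by transfer (simp add: norm_mult)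

lemma integrable_rep_L1: "integrable (lebesgue_on {0..1}) (rep_L1 f)"
  using Quotient_rep_reflp[OF Quotient_L1, of f] by simp

lemma Abs_rep_L1: "Abs_L1 (rep_L1 f) = f"
  by (rule Quotient_abs_rep[OF Quotient_L1])

lemma norm_Abs_L1:
  assumes "integrable (lebesgue_on {0..1}) f"
  shows "norm (Abs_L1 f) = integral\<^sup>L (lebesgue_on {0..1}) (\<lambda>x. norm (f x))"
  using assms by (simp add: norm_L1.abs_eq)

lemma sum_Abs_L1:
  fixes f :: "nat \<Rightarrow> real \<Rightarrow> 'a::{banach, second_countable_topology}"
  assumes "\<And>k. integrable (lebesgue_on {0..1}) (f k)"
  shows "(\<Sum>k<n. Abs_L1 (f k)) = Abs_L1 (\<lambda>x. \<Sum>k<n. f k x)"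
proof (induction n)
  case 0
  show ?case by (simp add: zero_L1_def)
next
  case (Suc n)
  have "integrable (lebesgue_on {0..1}) (\<lambda>x. \<Sum>k<n. f k x)"
    using assms by auto
  with Suc assms show ?case by (simp add: plus_L1.abs_eq)
qed

lemma L1_summable_norm_imp_convergent:
  fixes d :: "nat \<Rightarrow> 'a::{banach, second_countable_topology} L1"
  assumes d: "summable (\<lambda>k. norm (d k))"
  shows "convergent (\<lambda>n. \<Sum>k<n. d k)"
proof -
  let ?M = "lebesgue_on {0..1::real}"
  define f where "f k = rep_L1 (d k)" for k
  have f: "integrable ?M (f k)" for k
    unfolding f_def by (rule integrable_rep_L1)
  note [measurable] = borel_measurable_integrable[OF f]
  have Abs_f: "Abs_L1 (f k) = d k" for k
    by (simp add: f_def Abs_rep_L1)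
  have norm_f: "integral\<^sup>L ?M (\<lambda>x. norm (f k x)) = norm (d k)" for k
    using norm_Abs_L1[OF f, of k] by (simp add: Abs_f)
  have nn: "(\<integral>\<^sup>+x. ennreal (norm (f k x)) \<partial>?M) = ennreal (norm (d k))" for k
    using f[of k] by (subst nn_integral_eq_integral) (auto simp: norm_f)
  have "(\<integral>\<^sup>+x. (\<Sum>k. ennreal (norm (f k x))) \<partial>?M) = (\<Sum>k. ennreal (norm (d k)))"
    by (subst nn_integral_suminf) (auto simp: nn)
  also have "\<dots> \<noteq> \<infinity>"
    using ennreal_suminf_neq_top[OF d norm_ge_zero] by (simp only: infinity_ennreal_def not_False_eq_True)
  finally have "AE x in ?M. (\<Sum>k. ennreal (norm (f k x))) \<noteq> \<infinity>"
    by (intro nn_integral_PInf_AE) auto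
  hence ae: "AE x in ?M. summable (\<lambda>k. norm (f k x))"
    by eventually_elim (auto intro: summable_suminf_not_top)
  define S where "S x = (\<Sum>k. f k x)" for x
  define W where "W x = (\<Sum>k. norm (f k x))" for x
  have S: "integrable ?M S"
    unfolding S_def by (rule integrable_suminf[OF f]) (use ae d in \<open>auto simp: norm_f\<close>)
  have W: "integrable ?M W"
    unfolding W_def
    by (rule integrable_suminf) (use ae d f in \<open>auto simp: norm_f\<close>)
  note [measurable] = borel_measurable_integrable[OF S] borel_measurable_integrable[OF W]
  have "(\<lambda>n. integral\<^sup>L ?M (\<lambda>x. norm (S x - (\<Sum>k<n. f k x)))) \<longlonglongrightarrow> integral\<^sup>L ?M (\<lambda>x. 0 :: real)"
  proof (rule integral_dominated_convergence[OF _ _ W])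
    show "(\<lambda>x. norm (S x - (\<Sum>k<n. f k x))) \<in> borel_measurable ?M" for n
      by measurable
    show "AE x in ?M. (\<lambda>n. norm (S x - (\<Sum>k<n. f k x))) \<longlonglongrightarrow> 0"
      using ae
    proof eventually_elim
      case (elim x)
      hence "(\<lambda>n. \<Sum>k<n. f k x) \<longlonglongrightarrow> S x"
        unfolding S_def by (rule summable_LIMSEQ[OF summable_norm_cancel])
      from tendsto_diff[OF tendsto_const[of "S x"] this] show ?case
        by (intro tendsto_norm_zero) simp
    qed
    show "AE x in ?M. norm (norm (S x - (\<Sum>k<n. f k x))) \<le> W x" for n
      using ae
    proof eventually_elim
      case (elim x)
      have "S x - (\<Sum>k<n. f k x) = (\<Sum>k. f (k + n) x)"
        unfolding S_def using suminf_minus_initial_segment[OF summable_norm_cancel[OF elim], of n]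
        by simp
      also have "norm \<dots> \<le> (\<Sum>k. norm (f (k + n) x))"
        by (rule summable_norm) (use summable_iff_shift[of "\<lambda>k. norm (f k x)" n] elim in simp)
      also have "\<dots> = W x - (\<Sum>k<n. norm (f k x))"
        unfolding W_def by (rule suminf_minus_initial_segment[OF elim])
      also have "\<dots> \<le> W x"
        by (simp add: sum_nonneg)
      finally show ?case by simp
    qed
  qed simp
  moreover have "integral\<^sup>L ?M (\<lambda>x. norm (S x - (\<Sum>k<n. f k x))) = norm (Abs_L1 S - (\<Sum>k<n. d k))" for n
  proof -
    have I: "integrable ?M (\<lambda>x. \<Sum>k<n. f k x)" using f by auto
    have "Abs_L1 S - (\<Sum>k<n. d k) = Abs_L1 S - Abs_L1 (\<lambda>x. \<Sum>k<n. f k x)"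
      by (simp add: sum_Abs_L1[OF f, symmetric] Abs_f)
    also have "\<dots> = Abs_L1 (\<lambda>x. S x - (\<Sum>k<n. f k x))"
      using S I by (simp add: minus_L1.abs_eq)
    finally show ?thesis
      using S I by (simp add: norm_Abs_L1)
  qed
  ultimately have "(\<lambda>n. norm ((\<Sum>k<n. d k) - Abs_L1 S)) \<longlonglongrightarrow> 0"
    by (simp add: norm_minus_commute)
  hence "(\<lambda>n. \<Sum>k<n. d k) \<longlonglongrightarrow> Abs_L1 S"
    by (rule LIM_zero_cancel[OF tendsto_norm_zero_cancel])
  thus ?thesis by (rule convergentI)
qed

instance L1 :: ("{banach, second_countable_topology}") banach
proof
  fix X :: "nat \<Rightarrow> 'a L1"
  assume X: "Cauchy X"
  have "\<exists>N. \<forall>m\<ge>N. \<forall>n\<ge>N. norm (X m - X n) < (1 / 2) ^ k" for k :: nat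
    using CauchyD[OF X, of "(1 / 2) ^ k"] by simp
  then obtain N where N: "\<And>k m n. m \<ge> N k \<Longrightarrow> n \<ge> N k \<Longrightarrow> norm (X m - X n) < (1 / 2) ^ k"
    by metis
  define r where "r = rec_nat (N 0) (\<lambda>k s. max (Suc s) (N (Suc k)))"
  have r_Suc: "r (Suc k) = max (Suc (r k)) (N (Suc k))" for k
    by (simp add: r_def)
  have r: "strict_mono r"
    by (intro strict_monoI_Suc) (simp add: r_Suc)
  have rN: "r k \<ge> N k" for k
    by (cases k) (auto simp: r_Suc, simp add: r_def)
  have "norm (X (r (Suc k)) - X (r k)) \<le> (1 / 2) ^ k" for k
    using N[of k "r (Suc k)" "r k"] rN[of k] strict_monoD[OF r, of k "Suc k"] by simp
  hence "summable (\<lambda>k. norm (X (r (Suc k)) - X (r k)))"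
    by (intro summable_comparison_test'[OF summable_geometric[of "1 / 2 :: real"]]) auto
  hence "convergent (\<lambda>n. \<Sum>k<n. X (r (Suc k)) - X (r k))"
    by (rule L1_summable_norm_imp_convergent)
  then obtain L where "(\<lambda>n. X (r n) - X (r 0)) \<longlonglongrightarrow> L"
    unfolding sum_lessThan_telescope[of "\<lambda>k. X (r k)"] convergent_def by blast
  from tendsto_add[OF this tendsto_const[of "X (r 0)"]]
  have "(X \<circ> r) \<longlonglongrightarrow> L + X (r 0)"
    by (simp add: o_def)
  from Cauchy_converges_subseq[OF X r this] show "convergent X"
    by (rule convergentI)
qed


section \<open>The Haar system\<close>

definition dyadic_intervals :: "nat \<Rightarrow> real set set"
  where "dyadic_intervals n = {{(real i - 1) / 2 ^ n ..< real i / 2 ^ n} | i. 1 \<le> i \<and> i \<le> 2 ^ n}"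

definition left_half :: "real set \<Rightarrow> real set"
  where "left_half I = {Inf I ..< (Inf I + Sup I) / 2}"

definition right_half :: "real set \<Rightarrow> real set"
  where "right_half I = {(Inf I + Sup I) / 2 ..< Sup I}"

lemma halves_atLeastLessThan:
  assumes "a < b"
  shows "left_half {a..<b} = {a..<(a + b) / 2}" "right_half {a..<b} = {(a + b) / 2..<b}"
  using assms by (simp_all add: left_half_def right_half_def)

text \<open>\<open>haar I\<close> is the class of \<open>h\<^sub>I\<close>; it is meant for half-open intervals \<open>I\<close> only.\<close>

lift_definition haar :: "real set \<Rightarrow> 'k::{real_normed_field, banach, second_countable_topology} L1"
  is "\<lambda>I x. indicator (left_half I) x - indicator (right_half I) x"
proof -
  fix I :: "real set"
  have *: "integrable (lebesgue_on {0..1}) (indicator {a..<b} :: real \<Rightarrow> 'k)" for a b :: real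
  proof (rule finite_measure.integrable_const_bound[where B = 1])
    show "finite_measure (lebesgue_on {0..1::real})"
      by (intro finite_measure_lebesgue_on) simp
    show "AE x in lebesgue_on {0..1}. norm (indicator {a..<b} x :: 'k) \<le> 1"
      by (auto split: split_indicator)
    have "{a..<b} \<in> sets lebesgue"
      by simp
    thus "(indicator {a..<b} :: real \<Rightarrow> 'k) \<in> borel_measurable (lebesgue_on {0..1})"
      by (intro measurable_restrict_space1 borel_measurable_indicator)
  qed
  have "integrable (lebesgue_on {0..1})
      (\<lambda>x. indicator (left_half I) x - indicator (right_half I) x :: 'k)"
    unfolding left_half_def right_half_def by (intro Bochner_Integration.integrable_diff *)
  thus "?thesis I"
    by simp
qed

definition haar_closed_span ::
    "nat set \<Rightarrow> 'k::{real_normed_field, banach, second_countable_topology} L1 set"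
  where "haar_closed_span N = closure (L1.span {haar I | I n. n \<in> N \<and> I \<in> dyadic_intervals n})"


section \<open>Isomorphism of subspaces\<close>

text \<open>
  The maps are linear over \<open>'k\<close>, the scalar field of the ambient \<open>L\<^sup>1\<close>. The definitions are
  meant for linear subspaces \<open>X\<close> and \<open>Y\<close>, closed under addition and \<open>scale_L1\<close>.
\<close>

definition bounded_linear_map_on ::
    "'k::{real_normed_field, banach, second_countable_topology} L1 set \<Rightarrow> ('k L1 \<Rightarrow> 'k L1) \<Rightarrow> bool"
  where "bounded_linear_map_on X T \<longleftrightarrow>
    (\<forall>f\<in>X. \<forall>g\<in>X. T (f + g) = T f + T g) \<and>
    (\<forall>c. \<forall>f\<in>X. T (scale_L1 c f) = scale_L1 c (T f)) \<and>
    (\<exists>C. \<forall>f\<in>X. norm (T f) \<le> C * norm f)"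

definition isomorphic_subspaces ::
    "'k::{real_normed_field, banach, second_countable_topology} L1 set \<Rightarrow> 'k L1 set \<Rightarrow> bool"
  where "isomorphic_subspaces X Y \<longleftrightarrow>
    (\<exists>T. bij_betw T X Y \<and> bounded_linear_map_on X T \<and> bounded_linear_map_on Y (inv_into X T))"

end

theory Submission
  imports Defs
begin

text \<open>
  A bijection of dyadic intervals that changes the parity of the level is induced by bounded maps
  on all of \<open>L\<^sup>1\<close>. Split \<open>[0,1)\<close> into the shells \<open>J\<^sub>m = [2\<^sup>-\<^sup>m, 2 \<cdot> 2\<^sup>-\<^sup>m)\<close>, \<open>m \<ge> 1\<close>. Subtracting the mean on
  \<open>J\<^sub>m\<close> and restricting to \<open>J\<^sub>m\<close> keeps the \<open>h\<^sub>I\<close> with \<open>I \<subseteq> J\<^sub>m\<close> and kills all other Haar functions; the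
  sum \<open>Q\<close> of these projections over the even \<open>m\<close> is bounded because the shells are disjoint. On the
  range of \<open>Q\<close> apply \<open>f \<mapsto> f(x/2)\<close>, on its kernel \<open>f \<mapsto> f(2x)\<close>. The result maps the even levels onto the
  odd ones, with inverse given by the same construction for odd \<open>m\<close> and the dilations exchanged.
  (This is Pelczynski's decomposition for \<open>X\<^sub>0 \<cong> X\<^sub>0 \<oplus> X\<^sub>0 \<cong> X\<^sub>1\<close>, made explicit.)
\<close>

section \<open>Bounded operators and closed spans\<close>

text \<open>On the whole space the facts about \<open>bounded_linear\<close> become available; real
  homogeneity is the case of scalars \<open>of_real r\<close>.\<close>

lemma bounded_linear_map_on_UNIV_iff:
  "bounded_linear_map_on UNIV T \<longleftrightarrow>
    bounded_linear T \<and> (\<forall>c f. T (scale_L1 c f) = scale_L1 c (T f))"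
proof (intro iffI conjI)
  assume "bounded_linear_map_on UNIV T"
  then
  obtain C where add: "\<And>f g. T (f + g) = T f + T g"
    and scale: "\<And>c f. T (scale_L1 c f) = scale_L1 c (T f)"
    and bound: "\<And>f. norm (T f) \<le> C * norm f"
    unfolding bounded_linear_map_on_def by blast
  show "bounded_linear T"
  proof (rule bounded_linear_intro)
    show "T (r *\<^sub>R f) = r *\<^sub>R T f" for r f
      using scale[of "of_real r" f] by (simp add: scale_L1_of_real)
    show "norm (T f) \<le> norm f * C" for f
      using bound[of f] by (simp add: mult.commute)
  qed (rule add)
next
  assume T: "bounded_linear T \<and> (\<forall>c f. T (scale_L1 c f) = scale_L1 c (T f))"
  then have "\<exists>C. \<forall>f. norm (T f) \<le> C * norm f"
    using bounded_linear.bounded[of T] by (simp add: mult.commute)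
  with T show "bounded_linear_map_on UNIV T"
    by (simp add: bounded_linear_map_on_def linear_add[OF bounded_linear.linear])
qed (simp add: bounded_linear_map_on_def)

lemma bounded_linear_map_on_subset:
  "bounded_linear_map_on Y T \<Longrightarrow> X \<subseteq> Y \<Longrightarrow> bounded_linear_map_on X T"
  unfolding bounded_linear_map_on_def by (meson subsetD)

lemma bounded_linear_map_on_compose:
  assumes "bounded_linear_map_on UNIV S" "bounded_linear_map_on UNIV T"
  shows "bounded_linear_map_on UNIV (\<lambda>f. S (T f))"
  using assms by (simp add: bounded_linear_map_on_UNIV_iff bounded_linear_compose)

lemma bounded_linear_map_on_add:
  assumes "bounded_linear_map_on UNIV S" "bounded_linear_map_on UNIV T"
  shows "bounded_linear_map_on UNIV (\<lambda>f. S f + T f)"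
  using assms
  by (simp add: bounded_linear_map_on_UNIV_iff bounded_linear_add L1.scale_right_distrib)

lemma bounded_linear_map_on_diff:
  assumes "bounded_linear_map_on UNIV S" "bounded_linear_map_on UNIV T"
  shows "bounded_linear_map_on UNIV (\<lambda>f. S f - T f)"
  using assms
  by (simp add: bounded_linear_map_on_UNIV_iff bounded_linear_sub L1.scale_right_diff_distrib)

lemma bounded_linear_map_on_ident: "bounded_linear_map_on UNIV (\<lambda>f. f)"
  by (simp add: bounded_linear_map_on_UNIV_iff bounded_linear_ident)

section \<open>Closed spans and extension from generators\<close>

lemma closure_span_add:
  assumes "f \<in> closure (L1.span A)" "g \<in> closure (L1.span A)"
  shows "f + g \<in> closure (L1.span A)"
proof -
  obtain u v where "\<And>n. u n \<in> L1.span A" "u \<longlonglongrightarrow> f" "\<And>n. v n \<in> L1.span A" "v \<longlonglongrightarrow> g"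
    using assms unfolding closure_sequential by blast
  then have "(\<lambda>n. u n + v n) \<longlonglongrightarrow> f + g" "\<And>n. u n + v n \<in> L1.span A"
    by (auto intro: tendsto_add L1.span_add)
  then show ?thesis
    unfolding closure_sequential by (intro exI[of _ "\<lambda>n. u n + v n"]) simp
qed

lemma bounded_linear_scale_L1: "bounded_linear (scale_L1 c)"
  by (rule bounded_linear_intro[where K = "norm c"])
    (auto simp: L1.scale_right_distrib norm_scale_L1 mult.commute L1.scale_left_commute
      simp flip: scale_L1_of_real)

lemma closure_span_scale:
  assumes "f \<in> closure (L1.span A)"
  shows "scale_L1 c f \<in> closure (L1.span A)"
proof -
  have "scale_L1 c ` closure (L1.span A) \<subseteq> closure (L1.span A)"
    using L1.span_scale[of _ A c] closure_subset[of "L1.span A"]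
    by (intro image_closure_subset linear_continuous_on bounded_linear_scale_L1) blast+
  then show ?thesis
    using assms by blast
qed

text \<open>Linearity carries the inclusion from the generators to the span, continuity carries it
  to the closure.\<close>

lemma image_closure_span_subset:
  assumes T: "bounded_linear_map_on UNIV T" and TA: "T ` A \<subseteq> closure (L1.span B)"
  shows "T ` closure (L1.span A) \<subseteq> closure (L1.span B)"
proof -
  have lin: "bounded_linear T" "\<And>c f. T (scale_L1 c f) = scale_L1 c (T f)"
    using T by (auto simp: bounded_linear_map_on_UNIV_iff)
  interpret T: bounded_linear T by (rule lin)
  have "T f \<in> closure (L1.span B)" if "f \<in> L1.span A" for f
    using that
  proof (induction rule: L1.span_induct_alt)
    case base
    then show ?case
      using L1.span_zero closure_subset by (metis T.zero subsetD)
  next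
    case (step c x y)
    then have "T x \<in> closure (L1.span B)"
      using TA by blast
    with step show ?case
      by (simp only: T.add lin(2)) (intro closure_span_add closure_span_scale)
  qed
  then show ?thesis
    by (intro image_closure_subset linear_continuous_on lin(1)) auto
qed

lemma eq_on_closure_span:
  assumes T: "bounded_linear_map_on UNIV T" and fixes_A: "\<And>a. a \<in> A \<Longrightarrow> T a = a"
    and f: "f \<in> closure (L1.span A)"
  shows "T f = f"
proof -
  \<comment> \<open>\<open>T\<close> minus the identity sends every generator to 0, and the closed
    span of \<open>{0}\<close> is trivial.\<close>
  have "T f - f \<in> closure (L1.span {0})"
    using image_closure_span_subset[OF bounded_linear_map_on_diff[OF T bounded_linear_map_on_ident], of A "{0}"]
      f fixes_A closure_subset[of "L1.span {0::'a L1}"] L1.span_zero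
    by (auto simp: image_subset_iff)
  then show ?thesis
    by simp
qed

text \<open>Both operators live on all of L1, so the two inverse laws have to be checked on
  generators only; linearity and continuity extend them to the closed spans. Away from the spans the
  operators need not be inverse.\<close>

lemma isomorphic_closure_spans:
  assumes T: "bounded_linear_map_on UNIV T" and S: "bounded_linear_map_on UNIV S"
    and TA: "T ` A \<subseteq> B" and SB: "S ` B \<subseteq> A"
    and ST: "\<And>a. a \<in> A \<Longrightarrow> S (T a) = a" and TS: "\<And>b. b \<in> B \<Longrightarrow> T (S b) = b"
  shows "isomorphic_subspaces (closure (L1.span A)) (closure (L1.span B))"
proof -
  let ?X = "closure (L1.span A)" and ?Y = "closure (L1.span B)"
  have sub: "C \<subseteq> closure (L1.span C)" for C :: "'a L1 set"
    using L1.span_superset closure_subset by blast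
  have TX: "T ` ?X \<subseteq> ?Y" and SY: "S ` ?Y \<subseteq> ?X"
    by (rule image_closure_span_subset[OF T order_trans[OF TA sub]]
        image_closure_span_subset[OF S order_trans[OF SB sub]])+
  have ST: "S (T f) = f" if "f \<in> ?X" for f
    by (rule eq_on_closure_span[OF bounded_linear_map_on_compose[OF S T] ST that])
  have TS: "T (S f) = f" if "f \<in> ?Y" for f
    by (rule eq_on_closure_span[OF bounded_linear_map_on_compose[OF T S] TS that])
  have bij: "bij_betw T ?X ?Y"
    using ST TS TX SY by (intro bij_betw_byWitness[where f' = S] ballI)
  have inv: "inv_into ?X T g = S g" if "g \<in> ?Y" for g
    using bij_betw_imp_inj_on[OF bij] SY that TS[OF that] by (intro inv_into_f_eq) auto
  \<comment> \<open>\<open>inv_into\<close> is known to agree with \<open>S\<close> on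
    \<open>?Y\<close> only; since \<open>?Y\<close> is closed under sums and multiples, this
    suffices for linearity.\<close>
  have "bounded_linear_map_on ?Y (inv_into ?X T)"
    using bounded_linear_map_on_subset[OF S subset_UNIV, of ?Y]
    unfolding bounded_linear_map_on_def
    by (simp add: inv closure_span_add closure_span_scale)
  then show ?thesis
    unfolding isomorphic_subspaces_def
    using bij bounded_linear_map_on_subset[OF T subset_UNIV] by blast
qed

section \<open>Dilations\<close>

abbreviation unit_measure :: "real measure"
  where "unit_measure \<equiv> lebesgue_on {0..1}"

text \<open>The indicator extends \<open>f\<close> by zero to the whole line, where substitution
  divides the integral of the norm by the modulus of \<open>c\<close>. Restricting back to [0,1] can
  only lose mass, hence an inequality.\<close>

lemma
  fixes f :: "real \<Rightarrow> 'a::{banach, second_countable_topology}"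
  assumes c: "c \<noteq> 0" and f: "integrable unit_measure f"
  shows integrable_dilate: "integrable unit_measure (\<lambda>x. indicator {0..1} (c * x) *\<^sub>R f (c * x))"
    and integral_norm_dilate: "integral\<^sup>L unit_measure (\<lambda>x. norm (indicator {0..1} (c * x) *\<^sub>R f (c * x)))
      \<le> integral\<^sup>L unit_measure (\<lambda>x. norm (f x)) / \<bar>c\<bar>"
proof -
  define g where "g x = indicator {0..1} x *\<^sub>R f x" for x :: real
  have g: "integrable lebesgue g"
    using f unfolding g_def by (subst (asm) integrable_restrict_space) auto
  have gc: "integrable lebesgue (\<lambda>x. g (c * x))"
  proof (subst integrable_norm_iff[symmetric])
    have "(\<lambda>x. g (c *\<^sub>R x)) \<in> borel_measurable lebesgue"
      by (rule measurable_compose[OF lebesgue_measurable_scaling borel_measurable_integrable[OF g]])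
    then show "(\<lambda>x. g (c * x)) \<in> borel_measurable lebesgue"
      by simp
    show "integrable lebesgue (\<lambda>x. norm (g (c * x)))"
      using lebesgue_integrable_real_affine[OF integrable_norm[OF g] c, of 0] by simp
  qed
  have "integrable unit_measure (\<lambda>x. g (c * x))"
    using gc by (subst integrable_restrict_space) (auto intro!: integrable_mult_indicator)
  then show "integrable unit_measure (\<lambda>x. indicator {0..1} (c * x) *\<^sub>R f (c * x))"
    by (simp add: g_def)
  have "integral\<^sup>L unit_measure (\<lambda>x. norm (g (c * x)))
      = integral\<^sup>L lebesgue (\<lambda>x. indicator {0..1} x *\<^sub>R norm (g (c * x)))"
    by (subst integral_restrict_space) auto
  also have "\<dots> \<le> integral\<^sup>L lebesgue (\<lambda>x. norm (g (c * x)))"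
    using gc by (intro integral_mono integrable_mult_indicator integrable_norm) (auto split: split_indicator)
  also have "\<dots> = integral\<^sup>L lebesgue (\<lambda>x. norm (g x)) / \<bar>c\<bar>"
    using lebesgue_integral_real_affine[OF c, of "\<lambda>x. norm (g x)" 0] c by simp
  also have "integral\<^sup>L lebesgue (\<lambda>x. norm (g x)) = integral\<^sup>L unit_measure (\<lambda>x. norm (f x))"
    by (subst integral_restrict_space) (auto simp: g_def)
  finally show "integral\<^sup>L unit_measure (\<lambda>x. norm (indicator {0..1} (c * x) *\<^sub>R f (c * x)))
      \<le> integral\<^sup>L unit_measure (\<lambda>x. norm (f x)) / \<bar>c\<bar>"
    by (simp add: g_def)
qed

text \<open>For \<open>c = 0\<close> the formula would depend on the single value
  \<open>f 0\<close>, which a class does not determine; that case is set to zero.\<close>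

lift_definition dilate :: "real \<Rightarrow> 'a::{banach, second_countable_topology} L1 \<Rightarrow> 'a L1"
  is "\<lambda>c f x. if c = 0 then 0 else indicator {0..1} (c * x) *\<^sub>R f (c * x)"
proof -
  fix c :: real and f g :: "real \<Rightarrow> 'a"
  assume A: "integrable unit_measure f \<and> integrable unit_measure g \<and> (AE x in unit_measure. f x = g x)"
  let ?D = "\<lambda>f x. if c = 0 then 0 else indicator {0..1} (c * x) *\<^sub>R f (c * x) :: 'a"
  have int: "integrable unit_measure (?D f)" "integrable unit_measure (?D g)"
    using A by (cases "c = 0"; simp add: integrable_dilate)+
  have "AE x in unit_measure. ?D f x = ?D g x"
  proof (cases "c = 0")
    case False
    \<comment> \<open>The dilate of a null function has norm zero by
      \<open>integral_norm_dilate\<close>; this replaces an argument about preimages of null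
      sets.\<close>
    let ?h = "\<lambda>x. f x - g x"
    have "integral\<^sup>L unit_measure (\<lambda>x. norm (?h x)) = 0"
      using A by (subst integral_nonneg_eq_0_iff_AE) auto
    moreover have "integrable unit_measure ?h"
      using A by auto
    ultimately have "integral\<^sup>L unit_measure (\<lambda>x. norm (indicator {0..1} (c * x) *\<^sub>R ?h (c * x))) \<le> 0"
      using integral_norm_dilate[OF False, of ?h] by simp
    moreover have "integrable unit_measure (\<lambda>x. indicator {0..1} (c * x) *\<^sub>R ?h (c * x))"
      using A by (intro integrable_dilate False) auto
    ultimately have "AE x in unit_measure. norm (indicator {0..1} (c * x) *\<^sub>R ?h (c * x)) = 0"
      by (subst integral_nonneg_eq_0_iff_AE[symmetric])
        (auto intro!: antisym simp del: norm_scaleR)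
    then show ?thesis
      by eventually_elim (auto simp: algebra_simps)
  qed simp
  with int show "integrable unit_measure (?D f) \<and> integrable unit_measure (?D g)
    \<and> (AE x in unit_measure. ?D f x = ?D g x)"
    by simp
qed

lemma norm_dilate_le: "norm (dilate c f) \<le> norm f / \<bar>c\<bar>"
  by (cases "c = 0"; transfer fixing: c) (auto simp: integral_norm_dilate simp del: norm_scaleR)

lemma bounded_linear_map_on_dilate: "bounded_linear_map_on UNIV (dilate c)"
  unfolding bounded_linear_map_on_def
proof (intro conjI ballI allI exI)
  fix f g :: "'a L1"
  show "dilate c (f + g) = dilate c f + dilate c g"
    by (cases "c = 0"; transfer fixing: c)
      (simp_all add: scaleR_add_right integrable_dilate Bochner_Integration.integrable_add)
  show "dilate c (scale_L1 k f) = scale_L1 k (dilate c f)" for k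
  proof (cases "c = 0")
    case False
    then show ?thesis
      by (transfer fixing: c k)
        (simp add: integrable_dilate integrable_mult_right flip: mult_scaleR_right)
  qed (transfer fixing: c k, simp)
  show "norm (dilate c f) \<le> 1 / \<bar>c\<bar> * norm f"
    using norm_dilate_le[of c f] by simp
qed

section \<open>Fluctuations on dyadic shells\<close>

text \<open>Dyadic interval number 1, counting from 0, of level \<open>m\<close>; for
  \<open>m \<ge> 1\<close> these intervals tile (0,1).\<close>

definition shell :: "nat \<Rightarrow> real set"
  where "shell m = {1 / 2 ^ m ..< 2 / 2 ^ m}"

lemma shell_lebesgue [measurable]: "shell m \<in> sets lebesgue"
  by (simp add: shell_def)

lemma integrable_indicator_unit:
  fixes f :: "real \<Rightarrow> 'a::{banach, second_countable_topology}"
  assumes "A \<in> sets lebesgue" and "integrable unit_measure f"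
  shows "integrable unit_measure (\<lambda>x. indicator A x *\<^sub>R f x)"
proof (rule Bochner_Integration.integrable_bound[OF assms(2)])
  have "indicator A \<in> borel_measurable unit_measure"
    by (intro measurable_restrict_space1 borel_measurable_indicator assms(1))
  then show "(\<lambda>x. indicator A x *\<^sub>R f x) \<in> borel_measurable unit_measure"
    using borel_measurable_integrable[OF assms(2)] by (rule borel_measurable_scaleR)
qed (auto split: split_indicator)

lemmas integrable_indicator_shell = integrable_indicator_unit[OF shell_lebesgue]

lemma integrable_unit_const: "integrable unit_measure (\<lambda>x. c :: 'a::{banach, second_countable_topology})"
  using finite_measure.integrable_const[OF finite_measure_lebesgue_on[of "{0..1::real}"]] by simp

lemma integrable_fluctuation:
  fixes f :: "real \<Rightarrow> 'a::{banach, second_countable_topology}"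
  assumes "integrable unit_measure f"
  shows "integrable unit_measure (\<lambda>x. indicator (shell m) x *\<^sub>R (f x - a))"
  by (intro integrable_indicator_shell Bochner_Integration.integrable_diff assms integrable_unit_const)

text \<open>\<open>shell 0\<close> meets \<open>[0,1]\<close> only in the point \<open>1\<close>, so \<open>fluctuation 0\<close> vanishes.\<close>

lift_definition fluctuation :: "nat \<Rightarrow> 'a::{banach, second_countable_topology} L1 \<Rightarrow> 'a L1"
  is "\<lambda>m f x. indicator (shell m) x *\<^sub>R
    (f x - 2 ^ m *\<^sub>R integral\<^sup>L unit_measure (\<lambda>t. indicator (shell m) t *\<^sub>R f t))"
proof -
  fix m :: nat and f g :: "real \<Rightarrow> 'a"
  assume A: "integrable unit_measure f \<and> integrable unit_measure g \<and> (AE x in unit_measure. f x = g x)"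
  then have "integral\<^sup>L unit_measure (\<lambda>t. indicator (shell m) t *\<^sub>R f t)
      = integral\<^sup>L unit_measure (\<lambda>t. indicator (shell m) t *\<^sub>R g t)"
    by (intro integral_cong_AE borel_measurable_integrable integrable_indicator_shell)
      (auto elim: eventually_mono)
  moreover from A have "AE x in unit_measure. f x = g x"
    by blast
  then have "AE x in unit_measure. indicator (shell m) x *\<^sub>R (f x - a) = indicator (shell m) x *\<^sub>R (g x - a)" for a
    by eventually_elim simp
  ultimately show "?thesis m f g"
    using A by (simp add: integrable_fluctuation del: scaleR_cancel_left)
qed

text \<open>Equality holds for \<open>m \<ge> 1\<close>, but \<open>shell 0\<close> is [1,2) and
  meets the unit interval in a null set.\<close>

lemma measure_shell_le: "integral\<^sup>L unit_measure (indicator (shell m)) \<le> (1 / 2 ^ m :: real)"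
proof -
  have "integral\<^sup>L unit_measure (indicator (shell m))
      = integral\<^sup>L lebesgue (\<lambda>x. indicator {0..1} x *\<^sub>R indicator (shell m) x :: real)"
    by (subst integral_restrict_space) auto
  also have "\<dots> = integral\<^sup>L lebesgue (indicator ({0..1} \<inter> shell m))"
    by (intro Bochner_Integration.integral_cong) (auto split: split_indicator)
  also have "\<dots> = measure lebesgue ({0..1} \<inter> shell m)"
    by simp
  also have "\<dots> \<le> measure lebesgue (shell m)"
    by (rule measure_mono_fmeasurable) (auto simp: shell_def bounded_set_imp_lmeasurable)
  also have "\<dots> = 1 / 2 ^ m"
    by (simp add: shell_def divide_right_mono flip: diff_divide_distrib)
  finally show ?thesis .
qed

section \<open>Disjointness of the shells and norm bounds\<close>

lemma mem_shell_iff: "x \<in> shell m \<longleftrightarrow> \<lfloor>2 ^ m * x\<rfloor> = 1"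
  by (simp add: shell_def floor_eq_iff field_simps)

lemma shell_unique:
  assumes "x \<in> shell m" "x \<in> shell n"
  shows "m = n"
proof (rule ccontr)
  have *: False if "x \<in> shell m" "x \<in> shell n" "m < n" for m n :: nat
  proof -
    \<comment> \<open>Going from level \<open>m\<close> to a higher level \<open>n\<close> at least
      doubles \<open>2 ^ m * x\<close>, which is at least 1, while \<open>2 ^ n * x\<close> should
      stay below 2.\<close>
    have "(2::real) * 2 ^ m \<le> 2 ^ n"
      using power_increasing[of "Suc m" n "2::real"] that by simp
    moreover have "0 < x"
      using that by (auto simp: shell_def intro: less_le_trans[rotated])
    ultimately have "2 * (2 ^ m * x) \<le> 2 ^ n * x"
      by (simp add: mult_right_mono mult.assoc[symmetric])
    then show False
      using that by (simp add: shell_def field_simps)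
  qed
  assume "m \<noteq> n"
  then show False
    using * assms by (meson linorder_neqE_nat)
qed

lemma sum_indicator_shell_le: "(\<Sum>m<N. indicator (shell m) x) \<le> (1::real)"
proof (cases "\<exists>m. x \<in> shell m")
  case True
  then obtain k where "x \<in> shell k" ..
  then have "indicator (shell m) x = (if k = m then 1 else 0 :: real)" for m
    using shell_unique[of x k m] by (auto simp: indicator_def)
  then show ?thesis by simp
qed simp

text \<open>One copy of the local mass accounts for \<open>f\<close>, the other for the subtracted
  constant, whose mass on the shell is at most that of \<open>f\<close>. The bound sees only the
  shell, so it can be summed over shells.\<close>

lemma norm_fluctuation_le:
  assumes "integrable unit_measure f"
  shows "norm (fluctuation m (Abs_L1 f))
    \<le> 2 * integral\<^sup>L unit_measure (\<lambda>x. indicator (shell m) x * norm (f x))"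
proof -
  let ?I = "\<lambda>g. integral\<^sup>L unit_measure (\<lambda>x. indicator (shell m) x *\<^sub>R g x)"
  \<comment> \<open>For \<open>m \<ge> 1\<close> this is the mean of \<open>f\<close> over the
    shell.\<close>
  define a where "a = 2 ^ m *\<^sub>R ?I f"
  have int: "integrable unit_measure (\<lambda>x. f x - a)"
    using assms integrable_unit_const by auto
  have intn: "integrable unit_measure (\<lambda>x. indicator (shell m) x *\<^sub>R norm (f x))"
    and inta: "integrable unit_measure (\<lambda>x. indicator (shell m) x *\<^sub>R norm a)"
    using integrable_indicator_shell[OF integrable_norm[OF assms]]
      integrable_indicator_shell[OF integrable_unit_const] by blast+
  have "norm a = 2 ^ m * norm (?I f)"
    by (simp add: a_def)
  also have "norm (?I f) \<le> ?I (\<lambda>x. norm (f x))"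
    using integral_norm_bound[of unit_measure "\<lambda>x. indicator (shell m) x *\<^sub>R f x"] by simp
  finally have "norm a \<le> 2 ^ m * ?I (\<lambda>x. norm (f x))"
    by simp
  then have a: "norm a / 2 ^ m \<le> ?I (\<lambda>x. norm (f x))"
    by (simp add: field_simps)
  have "norm (fluctuation m (Abs_L1 f))
      = integral\<^sup>L unit_measure (\<lambda>x. norm (indicator (shell m) x *\<^sub>R (f x - a)))"
    using assms integrable_fluctuation[OF assms, of m]
    by (simp add: fluctuation.abs_eq norm_Abs_L1 a_def del: norm_scaleR)
  also have "\<dots> \<le> integral\<^sup>L unit_measure
      (\<lambda>x. indicator (shell m) x *\<^sub>R norm (f x) + indicator (shell m) x *\<^sub>R norm a)"
    using integrable_norm[OF integrable_indicator_shell[OF int, of m]] intn inta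
    by (intro integral_mono Bochner_Integration.integrable_add)
      (auto split: split_indicator intro: norm_triangle_ineq4)
  also have "\<dots> = ?I (\<lambda>x. norm (f x)) + integral\<^sup>L unit_measure (indicator (shell m)) * norm a"
    using intn inta by simp
  also have "\<dots> \<le> ?I (\<lambda>x. norm (f x)) + 1 / 2 ^ m * norm a"
    by (intro add_left_mono mult_right_mono measure_shell_le) simp
  also have "\<dots> \<le> 2 * ?I (\<lambda>x. norm (f x))"
    using a by simp
  finally show ?thesis
    by simp
qed

text \<open>Disjoint shells share out the mass of \<open>f\<close>, so the bound is uniform in
  \<open>N\<close> and the series over all shells converges absolutely.\<close>

lemma sum_norm_fluctuation_le: "(\<Sum>m<N. norm (fluctuation m f)) \<le> 2 * norm f"
proof -
  define g where "g = rep_L1 f"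
  have g: "integrable unit_measure g" "Abs_L1 g = f"
    by (simp_all add: g_def integrable_rep_L1 Abs_rep_L1)
  have int: "integrable unit_measure (\<lambda>x. indicator (shell m) x * norm (g x))" for m
    using integrable_indicator_shell[OF integrable_norm[OF g(1)], of m] by simp
  have "(\<Sum>m<N. norm (fluctuation m f))
      \<le> (\<Sum>m<N. 2 * integral\<^sup>L unit_measure (\<lambda>x. indicator (shell m) x * norm (g x)))"
    using norm_fluctuation_le[OF g(1)] by (intro sum_mono) (simp add: g(2))
  also have "\<dots> = 2 * integral\<^sup>L unit_measure (\<lambda>x. \<Sum>m<N. indicator (shell m) x * norm (g x))"
    using int by (simp add: sum_distrib_left del: sum_indicator_mult)
  also have "\<dots> \<le> 2 * integral\<^sup>L unit_measure (\<lambda>x. norm (g x))"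
  proof (intro mult_left_mono integral_mono)
    show "(\<Sum>m<N. indicator (shell m) x * norm (g x)) \<le> norm (g x)" for x
      using mult_right_mono[OF sum_indicator_shell_le[of x N], of "norm (g x)"]
      by (simp add: sum_distrib_right)
  qed (use int g in \<open>auto simp del: sum_indicator_mult\<close>)
  also have "\<dots> = 2 * norm f"
    using norm_Abs_L1[OF g(1)] g(2) by simp
  finally show ?thesis .
qed

lemma fluctuation_add: "fluctuation m (f + g) = fluctuation m f + fluctuation m g"
proof (transfer, goal_cases)
  case A: (1 m f g)
  let ?I = "\<lambda>f. integral\<^sup>L unit_measure (\<lambda>t. indicator (shell m) t *\<^sub>R f t)"
  have I: "?I (\<lambda>t. f t + g t) = ?I f + ?I g"
    using A by (simp add: scaleR_add_right integrable_indicator_shell)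
  have "indicator (shell m) x *\<^sub>R (f x + g x - 2 ^ m *\<^sub>R (?I f + ?I g)) =
    indicator (shell m) x *\<^sub>R (f x - 2 ^ m *\<^sub>R ?I f) + indicator (shell m) x *\<^sub>R (g x - 2 ^ m *\<^sub>R ?I g)" for x
    by (simp add: algebra_simps)
  with A I show ?case
    using integrable_fluctuation[where f = f and m = m] integrable_fluctuation[where f = g and m = m]
      Bochner_Integration.integrable_add
    by (simp del: scaleR_add_right)
qed

lemma fluctuation_scale: "fluctuation m (scale_L1 c f) = scale_L1 c (fluctuation m f)"
proof (transfer, goal_cases)
  case A: (1 m c f)
  let ?I = "\<lambda>f. integral\<^sup>L unit_measure (\<lambda>t. indicator (shell m) t *\<^sub>R f t)"
  have I: "?I (\<lambda>t. c * f t) = c * ?I f"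
    using A integrable_indicator_shell by (simp flip: mult_scaleR_right)
  have "indicator (shell m) x *\<^sub>R (c * f x - 2 ^ m *\<^sub>R (c * ?I f)) =
    c * (indicator (shell m) x *\<^sub>R (f x - 2 ^ m *\<^sub>R ?I f))" for x
    by (simp add: algebra_simps)
  with A I show ?case
    using integrable_mult_right[OF integrable_fluctuation] by (simp del: mult_scaleR_right)
qed

section \<open>Projections onto unions of shells\<close>

definition shell_part :: "nat set \<Rightarrow> 'k::{real_normed_field, banach, second_countable_topology} L1 \<Rightarrow> 'k L1"
  where "shell_part P f = (\<Sum>m. if m \<in> P then fluctuation m f else 0)"

lemma
  shows summable_shell_part: "summable (\<lambda>m. norm (if m \<in> P then fluctuation m f else 0))"
    and norm_shell_part_le: "norm (shell_part P f) \<le> 2 * norm f"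
proof -
  have le: "(\<Sum>m<N. norm (if m \<in> P then fluctuation m f else 0)) \<le> 2 * norm f" for N
    by (rule order_trans[OF sum_mono sum_norm_fluctuation_le]) auto
  show s: "summable (\<lambda>m. norm (if m \<in> P then fluctuation m f else 0))"
    by (intro summableI_nonneg_bounded[OF _ le]) simp
  have "norm (shell_part P f) \<le> (\<Sum>m. norm (if m \<in> P then fluctuation m f else 0))"
    unfolding shell_part_def by (rule summable_norm[OF s])
  also have "\<dots> \<le> 2 * norm f"
    by (rule suminf_le_const[OF s le])
  finally show "norm (shell_part P f) \<le> 2 * norm f" .
qed

lemma bounded_linear_map_on_shell_part: "bounded_linear_map_on UNIV (shell_part P)"
  unfolding bounded_linear_map_on_def
proof (intro conjI ballI allI exI)
  note sums = summable_norm_cancel[OF summable_shell_part]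
  show "shell_part P (f + g) = shell_part P f + shell_part P g" for f g :: "'a L1"
    unfolding shell_part_def suminf_add[OF sums sums]
    by (intro suminf_cong) (simp add: fluctuation_add)
  show "shell_part P (scale_L1 c f) = scale_L1 c (shell_part P f)" for c and f :: "'a L1"
    unfolding shell_part_def bounded_linear.suminf[OF bounded_linear_scale_L1 sums]
    by (intro suminf_cong) (simp add: fluctuation_scale)
qed (rule norm_shell_part_le)

section \<open>Action on the Haar system\<close>

text \<open>Counting from 0 lets dilations keep the index: scaling \<open>dyadic n i\<close> by 1/2
  gives \<open>dyadic (Suc n) i\<close>.\<close>

definition dyadic :: "nat \<Rightarrow> nat \<Rightarrow> real set"
  where "dyadic n i = {real i / 2 ^ n ..< (real i + 1) / 2 ^ n}"

lemma dyadic_intervals_eq: "dyadic_intervals n = {dyadic n i | i. i < 2 ^ n}"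
proof -
  let ?f = "\<lambda>i. {(real i - 1) / 2 ^ n ..< real i / 2 ^ n}"
  have "dyadic_intervals n = ?f ` {1..2 ^ n}"
    by (auto simp: dyadic_intervals_def)
  also have "{1..2 ^ n} = Suc ` {..<2 ^ n}"
    by (simp add: image_Suc_lessThan)
  also have "?f ` Suc ` {..<2 ^ n} = dyadic n ` {..<2 ^ n}"
    by (simp add: image_image dyadic_def[abs_def] add.commute)
  finally show ?thesis
    by blast
qed

lemma haar_closed_span_eq:
  "haar_closed_span N = closure (L1.span {haar (dyadic n i) | n i. n \<in> N \<and> i < 2 ^ n}
    :: 'k::{real_normed_field, banach, second_countable_topology} L1 set)"
proof -
  have "{haar I | I n. n \<in> N \<and> I \<in> dyadic_intervals n} =
      ({haar (dyadic n i) | n i. n \<in> N \<and> i < 2 ^ n} :: 'k L1 set)"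
    unfolding dyadic_intervals_eq by blast
  then show ?thesis
    by (simp only: haar_closed_span_def)
qed

text \<open>A representative read off from binary digits: the floor at level \<open>n\<close>
  selects the interval, and the parity of the floor one level deeper is the next digit, which
  selects the half.\<close>

definition haar_fun :: "nat \<Rightarrow> nat \<Rightarrow> real \<Rightarrow> 'k::{real_normed_field, banach, second_countable_topology}"
  where "haar_fun n i x =
    (if \<lfloor>2 ^ n * x\<rfloor> = int i then if even \<lfloor>2 ^ Suc n * x\<rfloor> then 1 else - 1 else 0)"

text \<open>Coarsening by \<open>k\<close> levels drops the last \<open>k\<close> binary
  digits.\<close>

lemma floor_power_mult: "\<lfloor>2 ^ n * x\<rfloor> = \<lfloor>2 ^ (n + k) * x\<rfloor> div 2 ^ k" for x :: real
  using floor_divide_real_eq_div[of "2 ^ k" "2 ^ (n + k) * x"] by (simp add: power_add)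

lemma haar_fun_eq_indicator:
  "haar_fun n i = (\<lambda>x. indicator {real i / 2 ^ n ..< (real i + 1 / 2) / 2 ^ n} x *\<^sub>R 1
    - indicator {(real i + 1 / 2) / 2 ^ n ..< (real i + 1) / 2 ^ n} x *\<^sub>R 1)"
proof
  fix x :: real
  \<comment> \<open>The cell of \<open>x\<close> one level deeper; cell \<open>i\<close> of level
    \<open>n\<close> has the children \<open>2 * i\<close> and \<open>2 * i + 1\<close>.\<close>
  define k where "k = \<lfloor>2 ^ Suc n * x\<rfloor>"
  have n: "\<lfloor>2 ^ n * x\<rfloor> = k div 2"
    using floor_power_mult[of n x 1] by (simp add: k_def)
  have "x \<in> {real i / 2 ^ n ..< (real i + 1 / 2) / 2 ^ n} \<longleftrightarrow> k = 2 * int i"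
    "x \<in> {(real i + 1 / 2) / 2 ^ n ..< (real i + 1) / 2 ^ n} \<longleftrightarrow> k = 2 * int i + 1"
    by (auto simp: k_def floor_eq_iff field_simps)
  moreover have "k div 2 = int i \<longleftrightarrow> k = 2 * int i \<or> k = 2 * int i + 1"
    by presburger
  ultimately show "haar_fun n i x = indicator {real i / 2 ^ n ..< (real i + 1 / 2) / 2 ^ n} x *\<^sub>R 1
    - indicator {(real i + 1 / 2) / 2 ^ n ..< (real i + 1) / 2 ^ n} x *\<^sub>R (1 :: 'a)"
    unfolding haar_fun_def n k_def[symmetric] by (auto simp: indicator_def)
qed

lemma haar_dyadic:
  "haar (dyadic n i) =
    Abs_L1 (haar_fun n i :: real \<Rightarrow> 'k::{real_normed_field, banach, second_countable_topology})"
proof -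
  have lt: "real i / 2 ^ n < (real i + 1) / 2 ^ n"
    by (simp add: divide_strict_right_mono)
  have mid: "(real i / 2 ^ n + (real i + 1) / 2 ^ n) / 2 = (real i + 1 / 2) / 2 ^ n"
    by (simp add: field_simps)
  have ind: "indicator A x *\<^sub>R 1 = (indicator A x :: 'k)" for A and x :: real
    by (simp add: indicator_def)
  show ?thesis
    unfolding haar_def haar_fun_eq_indicator dyadic_def
    by (simp only: map_fun_apply id_apply halves_atLeastLessThan[OF lt] mid ind)
qed

section \<open>Integrals and dilations of Haar functions\<close>

lemma integral_indicator_unit:
  fixes c :: "'a::{banach, second_countable_topology}"
  assumes "0 \<le> a" "a \<le> b" "b \<le> 1"
  shows "integral\<^sup>L unit_measure (\<lambda>x. indicator {a..<b} x *\<^sub>R c) = (b - a) *\<^sub>R c"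
proof -
  have "integral\<^sup>L unit_measure (\<lambda>x. indicator {a..<b} x *\<^sub>R c)
      = integral\<^sup>L lebesgue (\<lambda>x. indicator {0..1} x *\<^sub>R indicator {a..<b} x *\<^sub>R c)"
    by (subst integral_restrict_space) auto
  also have "\<dots> = integral\<^sup>L lebesgue (\<lambda>x. indicator {a..<b} x *\<^sub>R c)"
    using assms by (intro Bochner_Integration.integral_cong) (auto split: split_indicator)
  also have "\<dots> = (b - a) *\<^sub>R c"
    using assms by simp
  finally show ?thesis .
qed

lemma integrable_haar_fun: "integrable unit_measure (haar_fun n i)"
  unfolding haar_fun_eq_indicator
  by (intro Bochner_Integration.integrable_diff integrable_indicator_unit integrable_unit_const) simp_all

lemma integral_haar_fun:
  assumes "i < 2 ^ n"
  shows "integral\<^sup>L unit_measure (haar_fun n i :: real \<Rightarrow> 'k::{real_normed_field, banach, second_countable_topology}) = 0"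
proof -
  let ?a = "real i / 2 ^ n" and ?b = "(real i + 1 / 2) / 2 ^ n" and ?c = "(real i + 1) / 2 ^ n"
  \<comment> \<open>The whole interval lies inside [0,1], so both halves count with their full
    length.\<close>
  have "Suc i \<le> 2 ^ n"
    using assms by simp
  then have "real (Suc i) \<le> real (2 ^ n)"
    by (simp only: of_nat_le_iff)
  then have c: "?c \<le> 1"
    by (simp add: add.commute)
  have ab: "0 \<le> ?a" "?a \<le> ?b" "?b \<le> ?c"
    by (simp_all add: divide_right_mono)
  have int: "integrable unit_measure (\<lambda>x. indicator {a..<b} x *\<^sub>R (1 :: 'k))" for a b :: real
    by (intro integrable_indicator_unit integrable_unit_const) simp
  have "integral\<^sup>L unit_measure (haar_fun n i :: real \<Rightarrow> 'k) = (?b - ?a) *\<^sub>R 1 - (?c - ?b) *\<^sub>R 1"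
    unfolding haar_fun_eq_indicator Bochner_Integration.integral_diff[OF int int]
    using c ab by (intro arg_cong2[where f = "(-)"] integral_indicator_unit) linarith+
  also have "?b - ?a = ?c - ?b"
    by (simp add: field_simps)
  finally show ?thesis
    by simp
qed

text \<open>The second identity has level \<open>Suc n\<close> but index below \<open>2 ^ n\<close>:
  only intervals in the left half of [0,1) can be doubled.\<close>

lemma dilate_haar:
  assumes "i < 2 ^ n"
  shows "dilate 2 (haar (dyadic n i)) =
      (haar (dyadic (Suc n) i) :: 'a::{real_normed_field, banach, second_countable_topology} L1)"
    and "dilate (1 / 2) (haar (dyadic (Suc n) i)) = (haar (dyadic n i) :: 'a L1)"
proof -
  \<comment> \<open>The function vanishes off [0,1], so the cut-off in \<open>dilate\<close> does no
    harm.\<close>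
  have supp: "0 \<le> x \<and> x \<le> 1" if "\<lfloor>2 ^ n * x\<rfloor> = int i" for x :: real
  proof -
    have "real i \<le> 2 ^ n * x" "2 ^ n * x < real i + 1"
      using that by (simp_all add: floor_eq_iff)
    moreover have "real i + 1 \<le> 2 ^ n"
      using assms by (metis Suc_leI of_nat_Suc of_nat_le_iff of_nat_numeral of_nat_power add.commute)
    ultimately have "0 \<le> 2 ^ n * x" "2 ^ n * x < 2 ^ n * 1"
      by linarith+
    then show ?thesis
      using mult_le_cancel_left_pos[of "2 ^ n" 0 x] by simp
  qed
  have "haar_fun n i (2 * x) = (haar_fun (Suc n) i x :: 'a)" for x
    by (simp add: haar_fun_def ac_simps)
  moreover have "indicator {0..1} (2 * x) *\<^sub>R haar_fun n i (2 * x) = (haar_fun n i (2 * x) :: 'a)" for x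
    using supp[of "2 * x"] by (cases "\<lfloor>2 ^ n * (2 * x)\<rfloor> = int i") (simp_all add: haar_fun_def)
  ultimately have "indicator {0..1} (2 * x) *\<^sub>R haar_fun n i (2 * x) = (haar_fun (Suc n) i x :: 'a)" for x
    by simp
  then show "dilate 2 (haar (dyadic n i)) = (haar (dyadic (Suc n) i) :: 'a L1)"
    by (simp add: haar_dyadic dilate.abs_eq integrable_haar_fun)
  have "2 ^ Suc k * (1 / 2 * x) = 2 ^ k * x" for k and x :: real
    by simp
  then have "haar_fun (Suc n) i (1 / 2 * x) = (haar_fun n i x :: 'a)" for x
    by (simp only: haar_fun_def)
  moreover have "indicator {0..1} (1 / 2 * x) *\<^sub>R haar_fun n i x = (haar_fun n i x :: 'a)" for x
    using supp[of x] by (cases "\<lfloor>2 ^ n * x\<rfloor> = int i") (simp_all add: haar_fun_def)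
  ultimately have "indicator {0..1} (1 / 2 * x) *\<^sub>R haar_fun (Suc n) i (1 / 2 * x) = (haar_fun n i x :: 'a)" for x
    by simp
  then show "dilate (1 / 2) (haar (dyadic (Suc n) i)) = (haar (dyadic n i) :: 'a L1)"
    by (simp add: haar_dyadic dilate.abs_eq integrable_haar_fun)
qed

text \<open>\<open>in_shell m n i\<close> expresses \<open>dyadic n i \<subseteq> shell m\<close>.\<close>

definition in_shell :: "nat \<Rightarrow> nat \<Rightarrow> nat \<Rightarrow> bool"
  where "in_shell m n i \<longleftrightarrow> m \<le> n \<and> i div 2 ^ (n - m) = 1"

text \<open>A dilation shifts the levels of interval and shell together and fixes the index, so it
  flips the parity of the surrounding shell.\<close>

lemma in_shell_Suc_Suc [simp]: "in_shell (Suc m) (Suc n) i \<longleftrightarrow> in_shell m n i"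
  by (simp add: in_shell_def)

text \<open>\<open>i div 2 ^ (n - m)\<close> is the index of the ancestor at level \<open>m\<close>.
  All proper ancestors of an interval with index 1 have index 0, so the index 1 occurs at most
  once.\<close>

lemma in_shell_unique:
  assumes "in_shell m n i" "in_shell m' n i"
  shows "m = m'"
proof (rule ccontr)
  have *: False if "in_shell m n i" "in_shell m' n i" "m < m'" for m m'
  proof -
    have "(2::nat) ^ (n - m) = 2 ^ (n - m') * 2 ^ (m' - m)"
      using that by (simp add: in_shell_def flip: power_add)
    then have "i div 2 ^ (n - m) = i div 2 ^ (n - m') div 2 ^ (m' - m)"
      by (simp only: div_mult2_eq)
    moreover have "1 < (2::nat) ^ (m' - m)"
      using that(3) by (intro one_less_power) auto
    ultimately show False
      using that by (simp add: in_shell_def)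
  qed
  assume "m \<noteq> m'"
  then show False
    using * assms by (meson linorder_neqE_nat)
qed

text \<open>If \<open>m \<le> n\<close>, the interval is inside the shell or disjoint from it, and
  the Haar function has mean zero. If \<open>m > n\<close>, the Haar function is constant on the
  shell and subtracting its mean kills it.\<close>

lemma fluctuation_haar:
  assumes i: "i < 2 ^ n"
  shows "fluctuation m (haar (dyadic n i) :: 'k L1) =
    (if in_shell m n i then haar (dyadic n i)
     else (0 :: 'k::{real_normed_field, banach, second_countable_topology} L1))"
proof -
  let ?h = "haar_fun n i :: real \<Rightarrow> 'k"
  let ?a = "2 ^ m *\<^sub>R integral\<^sup>L unit_measure (\<lambda>t. indicator (shell m) t *\<^sub>R ?h t)"
  have Q: "fluctuation m (haar (dyadic n i)) = Abs_L1 (\<lambda>x. indicator (shell m) x *\<^sub>R (?h x - ?a))"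
    by (simp add: haar_dyadic fluctuation.abs_eq integrable_haar_fun)
  show ?thesis
  proof (cases "m \<le> n")
    case True
    have "\<lfloor>2 ^ m * x\<rfloor> = int (i div 2 ^ (n - m))" if "?h x \<noteq> 0" for x
      using floor_power_mult[of m x "n - m"] that True
      by (auto simp: haar_fun_def zdiv_int split: if_splits)
    then have h: "indicator (shell m) x *\<^sub>R ?h x = (if in_shell m n i then ?h x else 0)" for x
      using True by (cases "?h x = 0") (auto simp: mem_shell_iff in_shell_def indicator_def)
    have "?a = 0"
      using integral_haar_fun[OF i] by (cases "in_shell m n i") (simp_all add: h)
    then show ?thesis
      unfolding Q using h by (simp add: haar_dyadic zero_L1_def)
  next
    case False
    \<comment> \<open>The constant value on the shell. When \<open>i = 0\<close>, the quotient is 1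
      exactly for \<open>m = Suc n\<close>, where the shell is the right half and the value is -1;
      deeper shells lie in the left half.\<close>
    define v :: 'k where "v = (if i = 0 then if even ((1::int) div 2 ^ (m - Suc n)) then 1 else - 1 else 0)"
    have v: "?h x = v" if "x \<in> shell m" for x
    proof -
      have "\<lfloor>2 ^ n * x\<rfloor> = 1 div 2 ^ (m - n)" "\<lfloor>2 ^ Suc n * x\<rfloor> = 1 div 2 ^ (m - Suc n)"
        using floor_power_mult[of n x "m - n"] floor_power_mult[of "Suc n" x "m - Suc n"] that False
        by (simp_all add: mem_shell_iff)
      moreover have "(1::int) div 2 ^ (m - n) = 0"
        using False by simp
      ultimately show ?thesis
        by (simp add: haar_fun_def v_def del: power_Suc)
    qed
    have "(\<lambda>t. indicator (shell m) t *\<^sub>R ?h t) = (\<lambda>t. indicator (shell m) t *\<^sub>R v)"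
      by (rule ext) (simp add: v split: split_indicator)
    \<comment> \<open>Here \<open>m\<close> is positive, so the shell lies in [0,1] with full length
      and the mean of the constant \<open>v\<close> is \<open>v\<close> itself.\<close>
    moreover have "(2::real) / 2 ^ m \<le> 1"
      using power_increasing[of 1 m "2::real"] False by simp
    ultimately have "?a = v"
      by (simp add: shell_def integral_indicator_unit divide_right_mono flip: diff_divide_distrib)
    then have z: "indicator (shell m) x *\<^sub>R (?h x - ?a) = 0" for x
      by (simp add: v split: split_indicator)
    then show ?thesis
      unfolding Q z using False by (simp add: in_shell_def zero_L1_def)
  qed
qed

lemma shell_part_haar:
  assumes "i < 2 ^ n"
  shows "shell_part P (haar (dyadic n i)) =
    (if \<exists>m\<in>P. in_shell m n i then haar (dyadic n i)
     else (0 :: 'a::{real_normed_field, banach, second_countable_topology} L1))"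
proof (cases "\<exists>m\<in>P. in_shell m n i")
  case True
  then obtain k where k: "k \<in> P" "in_shell k n i" ..
  \<comment> \<open>An interval lies in at most one shell, so a single term of the series
    survives.\<close>
  have "(if m \<in> P then fluctuation m (haar (dyadic n i)) else 0) =
      (if m = k then haar (dyadic n i) else (0 :: 'a L1))" for m
  proof (cases "m = k")
    case True
    with k show ?thesis
      by (simp add: fluctuation_haar[OF assms])
  next
    case False
    then have "\<not> in_shell m n i"
      using in_shell_unique k(2) by blast
    with False show ?thesis
      by (simp add: fluctuation_haar[OF assms])
  qed
  then have "shell_part P (haar (dyadic n i)) = (\<Sum>m. if m = k then haar (dyadic n i) else (0 :: 'a L1))"
    unfolding shell_part_def by (rule suminf_cong)
  also have "\<dots> = haar (dyadic n i)"
    by (rule sums_unique[OF sums_single, symmetric])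
  finally show ?thesis
    by (simp only: if_P[OF True])
next
  case False
  then have "(if m \<in> P then fluctuation m (haar (dyadic n i)) else 0) = (0 :: 'a L1)" for m
    by (simp add: fluctuation_haar[OF assms])
  then have "shell_part P (haar (dyadic n i)) = (\<Sum>m. 0 :: 'a L1)"
    unfolding shell_part_def by (rule suminf_cong)
  then show ?thesis
    by (simp only: if_not_P[OF False] suminf_zero)
qed

section \<open>The two mutually inverse dilation operators\<close>

definition shell_dilate ::
    "real \<Rightarrow> real \<Rightarrow> nat set \<Rightarrow> 'k::{real_normed_field, banach, second_countable_topology} L1 \<Rightarrow> 'k L1"
  where "shell_dilate c d P f = dilate c (f - shell_part P f) + dilate d (shell_part P f)"

lemma bounded_linear_map_on_shell_dilate: "bounded_linear_map_on UNIV (shell_dilate c d P)"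
  unfolding shell_dilate_def[abs_def]
  by (rule bounded_linear_map_on_add
      bounded_linear_map_on_compose[OF bounded_linear_map_on_dilate]
      bounded_linear_map_on_diff bounded_linear_map_on_ident bounded_linear_map_on_shell_part)+

lemma dilate_0 [simp]: "dilate c 0 = 0"
  using norm_dilate_le[of c 0] by simp

lemma shell_dilate_haar:
  assumes "i < 2 ^ n"
  shows "shell_dilate c d P (haar (dyadic n i)) =
    dilate (if \<exists>m\<in>P. in_shell m n i then d else c) (haar (dyadic n i))"
  by (simp add: shell_dilate_def shell_part_haar[OF assms])

text \<open>Shells with \<open>m \<ge> 2\<close> lie in [0,1/2), so intervals inside them can be
  doubled without leaving [0,1).\<close>

lemma less_power_if_in_shell:
  assumes "in_shell m (Suc n) i" "2 \<le> m"
  shows "i < 2 ^ n"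
proof -
  have "i < 2 * 2 ^ (Suc n - m)"
    using assms dividend_less_times_div[of "2 ^ (Suc n - m)" i] by (simp add: in_shell_def)
  also have "\<dots> = 2 ^ Suc (Suc n - m)"
    by simp
  also have "\<dots> \<le> 2 ^ n"
    using assms by (intro power_increasing) (auto simp: in_shell_def)
  finally show ?thesis .
qed

text \<open>The two maps send Haar functions to Haar functions: an interval lying in a shell of the relevant
  parity is doubled (halved), all others are halved (doubled). Doubling an interval inside an
  even shell gives one inside an odd shell, and halving any other interval never does, so the
  maps invert each other.\<close>

lemma isomorphic_haar_closed_spans:
  "isomorphic_subspaces
     (haar_closed_span {n. even n} :: 'k::{real_normed_field, banach, second_countable_topology} L1 set)
     (haar_closed_span {n. odd n} :: 'k L1 set)"
proof -
  let ?A = "{haar (dyadic n i) | n i. n \<in> {n. even n} \<and> i < 2 ^ n} :: 'k L1 set"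
  let ?B = "{haar (dyadic n i) | n i. n \<in> {n. odd n} \<and> i < 2 ^ n} :: 'k L1 set"
  let ?T = "shell_dilate 2 (1 / 2) {n. even n} :: 'k L1 \<Rightarrow> 'k L1"
  let ?S = "shell_dilate (1 / 2) 2 {n. odd n} :: 'k L1 \<Rightarrow> 'k L1"
  have T: "?T h \<in> ?B \<and> ?S (?T h) = h" if "h \<in> ?A" for h
  proof -
    obtain n i where h: "h = haar (dyadic n i)" and n: "even n" and i: "i < 2 ^ n"
      using \<open>h \<in> ?A\<close> by blast
    show ?thesis
    proof (cases "\<exists>m\<in>{m. even m}. in_shell m n i")
      case True
      then obtain m where m: "even m" "in_shell m n i"
        by blast
      \<comment> \<open>\<open>shell 0\<close> starts at 1, beyond every interval with
        \<open>i < 2 ^ n\<close>. An even \<open>m\<close> is therefore at least 2, which leaves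
        room for doubling.\<close>
      have "m \<noteq> 0"
        using m i by (intro notI) (simp add: in_shell_def)
      then obtain m' n' where Suc: "m = Suc m'" "n = Suc n'"
        using m by (cases m; cases n) (auto simp: in_shell_def)
      have "2 \<le> m"
        using m Suc by (cases m') auto
      then have i': "i < 2 ^ n'"
        using less_power_if_in_shell m(2) unfolding Suc(2) by blast
      have m': "\<exists>m\<in>{m. odd m}. in_shell m n' i"
        using m Suc by (intro bexI[of _ m']) auto
      have "?T h = haar (dyadic n' i)"
        unfolding h shell_dilate_haar[OF i] if_P[OF True] by (simp only: Suc dilate_haar(2)[OF i'])
      moreover have "?S (haar (dyadic n' i)) = h"
        unfolding h shell_dilate_haar[OF i'] if_P[OF m'] by (simp only: Suc dilate_haar(1)[OF i'])
      moreover have "odd n'"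
        using n Suc by simp
      then have "haar (dyadic n' i) \<in> ?B"
        using i' by blast
      ultimately show ?thesis
        by (simp only: simp_thms)
    next
      case False
      have i': "i < 2 ^ Suc n"
        using i by simp
      \<comment> \<open>An odd shell around the halved interval would come from an even shell around
        the original one, against the case assumption.\<close>
      have m': "\<not> (\<exists>m\<in>{m. odd m}. in_shell m (Suc n) i)"
      proof safe
        fix m assume "odd m" "in_shell m (Suc n) i"
        with False show False
          by (cases m) auto
      qed
      have "?T h = haar (dyadic (Suc n) i)"
        unfolding h shell_dilate_haar[OF i] if_not_P[OF False] by (rule dilate_haar(1)[OF i])
      moreover have "?S (haar (dyadic (Suc n) i)) = h"
        unfolding h shell_dilate_haar[OF i'] if_not_P[OF m'] by (rule dilate_haar(2)[OF i])
      moreover have "odd (Suc n)"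
        using n by simp
      then have "haar (dyadic (Suc n) i) \<in> ?B"
        using i' by blast
      ultimately show ?thesis
        by (simp only: simp_thms)
    qed
  qed
  have S: "?S h \<in> ?A \<and> ?T (?S h) = h" if "h \<in> ?B" for h
  proof -
    obtain n i where h: "h = haar (dyadic n i)" and n: "odd n" and i: "i < 2 ^ n"
      using \<open>h \<in> ?B\<close> by blast
    show ?thesis
    proof (cases "\<exists>m\<in>{m. odd m}. in_shell m n i")
      case True
      have i': "i < 2 ^ Suc n"
        using i by simp
      obtain m where "odd m" "in_shell m n i"
        using True by blast
      \<comment> \<open>Halving moves the interval from an odd shell to the next, even one, where
        \<open>?T\<close> doubles it back.\<close>
      then have m': "\<exists>m\<in>{m. even m}. in_shell m (Suc n) i"
        by (intro bexI[of _ "Suc m"]) auto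
      have "?S h = haar (dyadic (Suc n) i)"
        unfolding h shell_dilate_haar[OF i] if_P[OF True] by (rule dilate_haar(1)[OF i])
      moreover have "?T (haar (dyadic (Suc n) i)) = h"
        unfolding h shell_dilate_haar[OF i'] if_P[OF m'] by (rule dilate_haar(2)[OF i])
      moreover have "even (Suc n)"
        using n by simp
      then have "haar (dyadic (Suc n) i) \<in> ?A"
        using i' by blast
      ultimately show ?thesis
        by (simp only: simp_thms)
    next
      case False
      obtain n' where Suc: "n = Suc n'"
        using n by (cases n) auto
      \<comment> \<open>The right half of [0,1) is \<open>shell 1\<close>, an odd shell; an interval
        of positive level outside all odd shells thus lies in the left half and can be
        doubled.\<close>
      have i': "i < 2 ^ n'"
      proof (rule ccontr)
        assume "\<not> i < 2 ^ n'"
        then have "in_shell 1 n i"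
          using i by (auto simp: in_shell_def Suc intro!: div_nat_eqI)
        moreover have "odd (1::nat)"
          by simp
        ultimately show False
          using False by blast
      qed
      have m': "\<not> (\<exists>m\<in>{m. even m}. in_shell m n' i)"
      proof safe
        fix m assume "even m" "in_shell m n' i"
        then have "odd (Suc m)" "in_shell (Suc m) n i"
          by (simp_all add: Suc)
        with False show False
          by blast
      qed
      have "?S h = haar (dyadic n' i)"
        unfolding h shell_dilate_haar[OF i] if_not_P[OF False] by (simp only: Suc dilate_haar(2)[OF i'])
      moreover have "?T (haar (dyadic n' i)) = h"
        unfolding h shell_dilate_haar[OF i'] if_not_P[OF m'] by (simp only: Suc dilate_haar(1)[OF i'])
      moreover have "even n'"
        using n Suc by simp
      then have "haar (dyadic n' i) \<in> ?A"
        using i' by blast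
      ultimately show ?thesis
        by (simp only: simp_thms)
    qed
  qed
  show ?thesis
    unfolding haar_closed_span_eq
  proof (rule isomorphic_closure_spans)
    show "?T ` ?A \<subseteq> ?B"
      by (rule image_subsetI) (rule T[THEN conjunct1])
    show "?S ` ?B \<subseteq> ?A"
      by (rule image_subsetI) (rule S[THEN conjunct1])
    show "?S (?T h) = h" if "h \<in> ?A" for h
      by (rule T[OF that, THEN conjunct2])
    show "?T (?S h) = h" if "h \<in> ?B" for h
      by (rule S[OF that, THEN conjunct2])
  qed (rule bounded_linear_map_on_shell_dilate)+
qed

theorem proposition3p2:
  shows "isomorphic_subspaces
           (haar_closed_span {n. even n} :: real L1 set)
           (haar_closed_span {n. odd n} :: real L1 set)
       \<and> isomorphic_subspaces
           (haar_closed_span {n. even n} :: complex L1 set)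
           (haar_closed_span {n. odd n} :: complex L1 set)"
  by (intro conjI isomorphic_haar_closed_spans)

end
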